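(* For every virtual link diagram $D$ with a cut system $P$, the virtual link diagram $\phi(D,P)$ is normal.
   Context: A virtual link diagram is a generically immersed closed oriented 1-manifold in $\mathbb{R}^2$ each of whose double points is either a classical (positive or negative) crossing, with over/under information, or a virtual crossing, without over/under information. Normality and cut systems. Let $P$ be a finite set of points on the edges of $D$ (away from crossings). The abstract link diagram (ALD) associated with $(D,P)$ is the pair $(\Sigma,D_\Sigma)$ where $\Sigma$ is the compact surface obtained by thickening $D$: a disk at each classical crossing, bands along the edges, the two bands at a virtual crossing passing each other disjointly, and a half twist inserted in the band at each point of $P$; $D_\Sigma$ is the core diagram. It is normal (checkerboard colorable) if the regions of $\Sigma-|D_\Sigma|$ can be colored black and white so that adjacent regions have different colors. $P$ is a cut system of $D$, and its points are cut points, if the ALD associated with $(D,P)$ is normal. Equivalently, the segments of $D$ between consecutive classical crossings and points of $P$ can be oriented (independently of the given orientation of $D$, and passing straight through virtual crossings) so that at each classical crossing each of the two strands reverses orientation, one strand having both its ends directed into the crossing and the other having both its ends directed out of it, and at each point of $P$ the orientation reverses. A virtual link diagram $D$ is called normal if the ALD associated with $D$ (i.e. with $(D,\emptyset)$) is normal. The diagram $\phi(D,P)$. Place $(D,P)$ to the right of the $y$-axis with all crossings and points of $P=\{p_1,\dots,p_k\}$ having distinct $y$-coordinates, and let $(D^*,P^* )$ be a copy of $(D,P)$ to the left of the $y$-axis obtained by translation along the $x$-axis; $p_i^*$ is the copy of $p_i$. Let $l_i$ be the horizontal line through $p_i$ and $p_i^*$ (the strands being transverse to $l_i$). In a thin neighborhood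 $N(l_i)$ of each $l_i$, cut the strands at $p_i$ and $p_i^*$ and reconnect crosswise: the lower end at $p_i$ is joined to the upper end at $p_i^*$ and the lower end at $p_i^*$ is joined to the upper end at $p_i$, by arcs inside $N(l_i)$, all newly created double points being virtual crossings. Orientations are inherited from $D$ and $D^*$. The result is $\phi(D,P)$. *)

theory Defs
  imports "HOL-Analysis.Analysis"
begin

section \<open>Virtual link diagrams\<close>

text \<open>
  The plane is the type \<open>complex\<close>. A closed oriented 1-manifold immersed in it is given as
  finitely many regular \<open>C\<^sup>1\<close> arcs \<open>crv D a\<close>, parametrised by \<open>[0,1]\<close> in the direction
  of the orientation; the arc \<open>a\<close> is followed by the arc \<open>nxt D a\<close>, so that the circles
  of the 1-manifold are the cycles of the permutation \<open>nxt D\<close>. A smooth circle may be given as a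
  single arc, or subdivided at will at points which are not double points; corners are allowed
  at the joints, so polygonal diagrams are covered too.
  The points of the 1-manifold are the pairs \<open>(a, t)\<close> with \<open>0 \<le> t < 1\<close>.

  \<open>(x, y) \<in> over D\<close> says that \<open>x\<close> and \<open>y\<close> are the two preimages of a classical crossing and
  that the strand through \<open>x\<close> passes over the strand through \<open>y\<close>. All the other double points
  are virtual crossings. The sign of a classical crossing is determined by these data and the
  orientation, and is therefore not recorded separately.
\<close>

record 'a vdiagram =
  arcs :: "'a set"
  nxt :: "'a \<Rightarrow> 'a"
  crv :: "'a \<Rightarrow> real \<Rightarrow> complex"
  over :: "(('a \<times> real) \<times> ('a \<times> real)) set"

definition points :: "'a vdiagram \<Rightarrow> ('a \<times> real) set" where
  "points D = arcs D \<times> {0..<1}"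

definition loc :: "'a vdiagram \<Rightarrow> 'a \<times> real \<Rightarrow> complex" where
  "loc D x = crv D (fst x) (snd x)"

definition vel :: "'a vdiagram \<Rightarrow> 'a \<times> real \<Rightarrow> complex" where
  "vel D x = vector_derivative (crv D (fst x)) (at (snd x))"

definition cross_det :: "complex \<Rightarrow> complex \<Rightarrow> real" where
  "cross_det v w = Re v * Im w - Im v * Re w"

definition double_pair :: "'a vdiagram \<Rightarrow> 'a \<times> real \<Rightarrow> 'a \<times> real \<Rightarrow> bool" where
  "double_pair D x y \<longleftrightarrow> x \<in> points D \<and> y \<in> points D \<and> x \<noteq> y \<and> loc D x = loc D y"

definition double_points :: "'a vdiagram \<Rightarrow> ('a \<times> real) set" where
  "double_points D = {x. \<exists>y. double_pair D x y}"

definition virtual_link_diagram :: "'a vdiagram \<Rightarrow> bool" where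
  "virtual_link_diagram D \<longleftrightarrow>
     finite (arcs D) \<and> bij_betw (nxt D) (arcs D) (arcs D) \<and>
     \<comment> \<open>the arcs are regular, and fit together to an immersed closed 1-manifold (no cusps)\<close>
     (\<forall>a\<in>arcs D. crv D a C1_differentiable_on {0..1} \<and> (\<forall>t\<in>{0..1}. vel D (a, t) \<noteq> 0)) \<and>
     (\<forall>a\<in>arcs D. crv D a 1 = crv D (nxt D a) 0 \<and>
        \<not> (\<exists>c>0. vel D (nxt D a, 0) = - c *\<^sub>R vel D (a, 1))) \<and>
     \<comment> \<open>genericity: finitely many transverse double points, none of them at a joint,
         and no triple points\<close>
     finite (double_points D) \<and>
     (\<forall>x y. double_pair D x y \<longrightarrow> 0 < snd x \<and> cross_det (vel D x) (vel D y) \<noteq> 0) \<and>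
     (\<forall>x y z. double_pair D x y \<longrightarrow> double_pair D x z \<longrightarrow> y = z) \<and>
     \<comment> \<open>over/under information at some of the double points\<close>
     (\<forall>x y. (x, y) \<in> over D \<longrightarrow> double_pair D x y \<and> (y, x) \<notin> over D)"


section \<open>Abstract link diagrams, normality, cut systems\<close>

text \<open>
  A set of points on the edges of \<open>D\<close> is given as a set \<open>P \<subseteq> arcs D\<close>, where \<open>p \<in> P\<close> stands for
  the initial point \<open>crv D p 0\<close> of the arc \<open>p\<close>. This is no restriction, because \<open>D\<close> may be
  subdivided at any finite set of points which are not double points.

  The surface \<open>\<Sigma>\<close> of the abstract link diagram is obtained from the bands \<open>[0,1] \<times> [-w,w]\<close>, one for
  each arc, where \<open>(a, t, u)\<close> lies to the left of the arc \<open>a\<close> iff \<open>u > 0\<close>, as follows.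
  At a joint the bands are glued end to end, with a half twist if the joint is in \<open>P\<close>.
  At a classical crossing, with preimages \<open>(a, s)\<close> and \<open>(b, t)\<close>, the square
  \<open>[s-w,s+w] \<times> [-w,w]\<close> of the band of \<open>a\<close> is identified with the square
  \<open>[t-w,t+w] \<times> [-w,w]\<close> of the band of \<open>b\<close> in the way prescribed by the plane: if \<open>b\<close> crosses \<open>a\<close>
  from right to left, then the direction of \<open>b\<close> is the left of \<open>a\<close>, and the left
  of \<open>b\<close> is the direction opposite to \<open>a\<close>; both are reversed if \<open>b\<close> crosses \<open>a\<close> from left to right.
  This common square is the disk at the crossing. Nothing is identified at a virtual crossing.
\<close>

definition classical_points :: "'a vdiagram \<Rightarrow> ('a \<times> real) set" where
  "classical_points D = Domain (over D) \<union> Range (over D)"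

text \<open>The squares at the crossings have to be disjoint from each other and from the band ends.\<close>

definition band_width :: "'a vdiagram \<Rightarrow> real \<Rightarrow> bool" where
  "band_width D w \<longleftrightarrow> w > 0 \<and>
     (\<forall>a s. (a, s) \<in> classical_points D \<longrightarrow> w < s \<and> s + w < 1) \<and>
     (\<forall>a s s'. (a, s) \<in> classical_points D \<longrightarrow> (a, s') \<in> classical_points D \<longrightarrow> s \<noteq> s' \<longrightarrow>
        2 * w < \<bar>s - s'\<bar>)"

definition bands :: "'a vdiagram \<Rightarrow> real \<Rightarrow> ('a \<times> real \<times> real) topology" where
  "bands D w = prod_topology (discrete_topology (arcs D)) (top_of_set ({0..1} \<times> {-w..w}))"

inductive glue :: "'a vdiagram \<Rightarrow> 'a set \<Rightarrow> real \<Rightarrow> 'a \<times> real \<times> real \<Rightarrow> 'a \<times> real \<times> real \<Rightarrow> bool"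
  for D P w where
  joint: "a \<in> arcs D \<Longrightarrow> u \<in> {-w..w} \<Longrightarrow>
     glue D P w (a, 1, u) (nxt D a, 0, if nxt D a \<in> P then - u else u)"
| crossing: "((a, s), (b, t)) \<in> over D \<Longrightarrow> v \<in> {-w..w} \<Longrightarrow> u \<in> {-w..w} \<Longrightarrow>
     \<sigma> = sgn (cross_det (vel D (a, s)) (vel D (b, t))) \<Longrightarrow>
     glue D P w (a, s + v, u) (b, t + \<sigma> * u, - \<sigma> * v)"

definition ald_proj ::
  "'a vdiagram \<Rightarrow> 'a set \<Rightarrow> real \<Rightarrow> 'a \<times> real \<times> real \<Rightarrow> ('a \<times> real \<times> real) set" where
  "ald_proj D P w x = {y. equivclp (glue D P w) x y}"

definition quotient_topology :: "'a topology \<Rightarrow> ('a \<Rightarrow> 'b) \<Rightarrow> 'b topology" where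
  "quotient_topology X f =
     topology (\<lambda>U. U \<subseteq> f ` topspace X \<and> openin X {x \<in> topspace X. f x \<in> U})"

lemma openin_quotient_topology:
  "openin (quotient_topology X f) U \<longleftrightarrow>
     U \<subseteq> f ` topspace X \<and> openin X {x \<in> topspace X. f x \<in> U}"
proof -
  let ?L = "\<lambda>U. U \<subseteq> f ` topspace X \<and> openin X {x \<in> topspace X. f x \<in> U}"
  have "istopology ?L"
    unfolding istopology_def
  proof (intro conjI allI impI)
    fix S T assume "?L S" "?L T"
    moreover have "{x \<in> topspace X. f x \<in> S \<inter> T} =
        {x \<in> topspace X. f x \<in> S} \<inter> {x \<in> topspace X. f x \<in> T}" by blast
    ultimately show "openin X {x \<in> topspace X. f x \<in> S \<inter> T}" by auto
  next
    fix K assume K: "\<forall>S\<in>K. ?L S"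
    have "{x \<in> topspace X. f x \<in> \<Union>K} = (\<Union>S\<in>K. {x \<in> topspace X. f x \<in> S})" by blast
    then show "openin X {x \<in> topspace X. f x \<in> \<Union>K}" using K by auto
  qed auto
  then show ?thesis
    by (simp add: quotient_topology_def topology_inverse')
qed

lemma topspace_quotient_topology [simp]: "topspace (quotient_topology X f) = f ` topspace X"
proof -
  have "{x \<in> topspace X. f x \<in> f ` topspace X} = topspace X" by auto
  then have "openin (quotient_topology X f) (f ` topspace X)"
    by (simp add: openin_quotient_topology)
  then show ?thesis
    by (metis openin_quotient_topology openin_subset openin_topspace subset_antisym)
qed

lemma quotient_map_quotient_topology: "quotient_map X (quotient_topology X f) f"
  unfolding quotient_map_def by (auto simp: openin_quotient_topology)

definition ald_surface :: "'a vdiagram \<Rightarrow> 'a set \<Rightarrow> real \<Rightarrow> ('a \<times> real \<times> real) set topology" where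
  "ald_surface D P w = quotient_topology (bands D w) (ald_proj D P w)"

definition ald_core :: "'a vdiagram \<Rightarrow> 'a set \<Rightarrow> real \<Rightarrow> ('a \<times> real \<times> real) set set" where
  "ald_core D P w = {ald_proj D P w (a, t, 0) | a t. a \<in> arcs D \<and> t \<in> {0..1}}"

definition ald_regions :: "'a vdiagram \<Rightarrow> 'a set \<Rightarrow> real \<Rightarrow> ('a \<times> real \<times> real) set set set" where
  "ald_regions D P w = connected_components_of
     (subtopology (ald_surface D P w) (topspace (ald_surface D P w) - ald_core D P w))"

text \<open>
  Two regions are adjacent if they lie on the two sides of an edge of the core. A region may be
  adjacent to itself, in which case there is no checkerboard coloring.
\<close>

definition ald_adjacent ::
  "'a vdiagram \<Rightarrow> 'a set \<Rightarrow> real \<Rightarrow> ('a \<times> real \<times> real) set set \<Rightarrow> ('a \<times> real \<times> real) set set \<Rightarrow> bool"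
  where
  "ald_adjacent D P w R R' \<longleftrightarrow> (\<exists>a\<in>arcs D. \<exists>t\<in>{0..1}. \<exists>u\<in>{0<..w}.
     ald_proj D P w (a, t, u) \<in> R \<and> ald_proj D P w (a, t, - u) \<in> R')"

definition checkerboard_colorable :: "'a vdiagram \<Rightarrow> 'a set \<Rightarrow> real \<Rightarrow> bool" where
  "checkerboard_colorable D P w \<longleftrightarrow> (\<exists>black :: ('a \<times> real \<times> real) set set \<Rightarrow> bool.
     \<forall>R\<in>ald_regions D P w. \<forall>R'\<in>ald_regions D P w.
       ald_adjacent D P w R R' \<longrightarrow> black R \<noteq> black R')"

text \<open>The surface does not depend, up to homeomorphism, on the (small) width of the bands.\<close>

definition ald_normal :: "'a vdiagram \<Rightarrow> 'a set \<Rightarrow> bool" where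
  "ald_normal D P \<longleftrightarrow> (\<exists>w. band_width D w \<and> checkerboard_colorable D P w)"

definition cut_system :: "'a vdiagram \<Rightarrow> 'a set \<Rightarrow> bool" where
  "cut_system D P \<longleftrightarrow> P \<subseteq> arcs D \<and> ald_normal D P"

definition normal_diagram :: "'a vdiagram \<Rightarrow> bool" where
  "normal_diagram D \<longleftrightarrow> ald_normal D {}"


section \<open>The diagram \<open>\<phi>(D,P)\<close>\<close>

text \<open>
  Placing a diagram in the plane: it is moved by an orientation preserving \<open>C\<^sup>1\<close> diffeomorphism
  of the plane (each of these is isotopic to the identity).
\<close>

definition plane_diffeo :: "(complex \<Rightarrow> complex) \<Rightarrow> bool" where
  "plane_diffeo h \<longleftrightarrow> bij h \<and>
     (\<exists>h'. (\<forall>z. (h has_derivative h' z) (at z)) \<and>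
           (\<forall>v. continuous_on UNIV (\<lambda>z. h' z v)) \<and>
           (\<forall>z. cross_det (h' z 1) (h' z \<i>) > 0))"

definition move :: "(complex \<Rightarrow> complex) \<Rightarrow> 'a vdiagram \<Rightarrow> 'a vdiagram" where
  "move h D = D\<lparr>crv := \<lambda>a. h \<circ> crv D a\<rparr>"

definition special_points :: "'a vdiagram \<Rightarrow> 'a set \<Rightarrow> ('a \<times> real) set" where
  "special_points D P = double_points D \<union> (\<lambda>p. (p, 0)) ` P"

text \<open>
  \<open>D\<close> lies to the right of the \<open>y\<close>-axis, its translate by \<open>-\<tau>\<close> lies to the left of it, and
  the crossings and points of \<open>P\<close> have distinct \<open>y\<close>-coordinates.
\<close>

definition well_placed :: "'a vdiagram \<Rightarrow> 'a set \<Rightarrow> real \<Rightarrow> bool" where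
  "well_placed D P \<tau> \<longleftrightarrow>
     (\<forall>a\<in>arcs D. \<forall>t\<in>{0..1}. 0 < Re (crv D a t) \<and> Re (crv D a t) < \<tau>) \<and>
     inj_on Im (loc D ` special_points D P)"

definition strip :: "'a vdiagram \<Rightarrow> ('a \<Rightarrow> real) \<Rightarrow> 'a \<Rightarrow> complex set" where
  "strip D \<epsilon> p = {z. \<bar>Im z - Im (crv D p 0)\<bar> < \<epsilon> p}"

text \<open>
  \<open>strip D \<epsilon> p\<close> is the neighborhood \<open>N(l)\<close> of the horizontal line \<open>l\<close> through \<open>p\<close>. In order
  to cut the strand at \<open>p\<close>, its part inside \<open>N(l)\<close> formed by the final piece \<open>[hi a, 1]\<close> of the arc
  \<open>a\<close> that ends at \<open>p\<close> and by the initial piece \<open>[0, lo p]\<close> of the arc \<open>p\<close> is removed. This part is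
  transverse to all horizontal lines, so that one of its ends is the lower one.
\<close>

definition thin_cuts ::
  "'a vdiagram \<Rightarrow> 'a set \<Rightarrow> ('a \<Rightarrow> real) \<Rightarrow> ('a \<Rightarrow> real) \<Rightarrow> ('a \<Rightarrow> real) \<Rightarrow> bool" where
  "thin_cuts D P \<epsilon> lo hi \<longleftrightarrow>
     (\<forall>p\<in>P. \<epsilon> p > 0 \<and>
        (\<forall>x\<in>special_points D P. x \<noteq> (p, 0) \<longrightarrow> loc D x \<notin> strip D \<epsilon> p) \<and>
        (\<forall>q\<in>P. q \<noteq> p \<longrightarrow> strip D \<epsilon> p \<inter> strip D \<epsilon> q = {})) \<and>
     (\<forall>a\<in>arcs D. 0 \<le> lo a \<and> lo a < hi a \<and> hi a \<le> 1 \<and>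
        (a \<in> P \<longleftrightarrow> 0 < lo a) \<and> (nxt D a \<in> P \<longleftrightarrow> hi a < 1)) \<and>
     (\<forall>a\<in>arcs D. \<forall>p\<in>P. nxt D a = p \<longrightarrow>
        (\<forall>s\<in>{hi a..1}. \<forall>t\<in>{0..lo p}.
           crv D a s \<in> strip D \<epsilon> p \<and> crv D p t \<in> strip D \<epsilon> p \<and>
           Im (vel D (a, s)) * Im (vel D (p, t)) > 0))"

text \<open>
  Copy \<open>False\<close> is \<open>D\<close> and copy \<open>True\<close> is its translate \<open>D\<^sup>*\<close>. What is left of the arc \<open>a\<close> of copy \<open>i\<close>
  is \<open>Kept i a\<close>. The new arc \<open>Joining i p\<close> leads from the incoming end at the point \<open>p\<close> of
  copy \<open>i\<close> to the outgoing end at the point \<open>p\<close> of the other copy. Since the strands at the two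
  copies of \<open>p\<close> are parallel, one of these is the lower end and the other one the upper end, and the
  orientations of \<open>D\<close> and \<open>D\<^sup>*\<close> are inherited. The only classical crossings
  are those of the two copies.
\<close>

datatype 'a phi_arc = Kept bool 'a | Joining bool 'a

definition copy_shift :: "real \<Rightarrow> bool \<Rightarrow> complex" where
  "copy_shift \<tau> i = (if i then - of_real \<tau> else 0)"

definition phi_diagram ::
  "'a vdiagram \<Rightarrow> 'a set \<Rightarrow> real \<Rightarrow> ('a \<Rightarrow> real) \<Rightarrow> ('a \<Rightarrow> real) \<Rightarrow> (bool \<Rightarrow> 'a \<Rightarrow> real \<Rightarrow> complex) \<Rightarrow>
   'a phi_arc vdiagram" where
  "phi_diagram D P \<tau> lo hi \<gamma> =
     \<lparr> arcs = {Kept i a | i a. a \<in> arcs D} \<union> {Joining i p | i p. p \<in> P},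
       nxt = (\<lambda>e. case e of
           Kept i a \<Rightarrow> (if nxt D a \<in> P then Joining i (nxt D a) else Kept i (nxt D a))
         | Joining i p \<Rightarrow> Kept (\<not> i) p),
       crv = (\<lambda>e. case e of
           Kept i a \<Rightarrow> subpath (lo a) (hi a) (\<lambda>t. crv D a t + copy_shift \<tau> i)
         | Joining i p \<Rightarrow> \<gamma> i p),
       over = {((Kept i a, (s - lo a) / (hi a - lo a)), (Kept i b, (t - lo b) / (hi b - lo b)))
               | i a s b t. ((a, s), (b, t)) \<in> over D} \<rparr>"

text \<open>
  \<open>E\<close> is \<open>\<phi>(D,P)\<close>, for some choice of the placement of \<open>D\<close>, of the neighborhoods, and of the
  joining arcs. That the latter end at the right points and are in general position
  is part of the requirement that \<open>E\<close> is a virtual link diagram.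
\<close>

definition is_phi :: "'a vdiagram \<Rightarrow> 'a set \<Rightarrow> 'a phi_arc vdiagram \<Rightarrow> bool" where
  "is_phi D P E \<longleftrightarrow>
     (\<exists>h \<tau> \<epsilon> lo hi \<gamma>. plane_diffeo h \<and>
        well_placed (move h D) P \<tau> \<and> thin_cuts (move h D) P \<epsilon> lo hi \<and>
        (\<forall>i. \<forall>p\<in>P. \<gamma> i p ` {0..1} \<subseteq> strip (move h D) \<epsilon> p) \<and>
        E = phi_diagram (move h D) P \<tau> lo hi \<gamma> \<and> virtual_link_diagram E)"

end

theory Submission
  imports Defs
begin

text \<open>
  A checkerboard coloring of an abstract link diagram is the same thing as a coloring of the points
  of the 1-manifold off the classical crossings: color a point by the color of the region on its
  left; the region on its right has the other color. Such an edge coloring is constant between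
  crossings, changes at the points of \<open>P\<close>, and at a classical crossing changes along either strand,
  the two outgoing ends having different colors. This last rule does not depend on the sign of the
  crossing. (Orienting an edge along the diagram when its color is black turns it into the
  source-sink orientation by which cut systems are also described.) The equivalence of the two kinds
  of colorings is \<open>colorable_imp_edge_coloring\<close> and \<open>edge_coloring_imp_colorable\<close>.

  Now give \<open>D\<close> an edge coloring for the cut system \<open>P\<close>, and give the translate \<open>D\<^sup>*\<close> the
  opposite coloring. The rule at crossings is invariant under exchanging the colors. At a point \<open>p\<close> of
  \<open>P\<close>, the incoming end in one copy and the outgoing end in the same copy have different
  colors, hence the incoming end in one copy and the outgoing end in the other copy have the
  same color. These are the ends that \<open>\<phi>(D,P)\<close> joins, and the joining arcs meet
  virtual crossings only; so the colorings of the two copies fit together to an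
  edge coloring of \<open>\<phi>(D,P)\<close> without cut points (\<open>edge_coloring_phi_diagram\<close>).
\<close>

section \<open>Classical points and band widths\<close>

lemma classical_pointsE:
  assumes "x \<in> classical_points D"
  obtains y where "(x, y) \<in> over D \<or> (y, x) \<in> over D"
  using assms unfolding classical_points_def by blast

lemma over_double_pair:
  assumes "virtual_link_diagram D" "(x, y) \<in> over D"
  shows "double_pair D x y"
  using assms unfolding virtual_link_diagram_def by blast

lemma double_pair_sym: "double_pair D x y \<Longrightarrow> double_pair D y x"
  unfolding double_pair_def by auto

lemma classical_points_subset_double_points:
  assumes "virtual_link_diagram D"
  shows "classical_points D \<subseteq> double_points D"
proof
  fix x assume "x \<in> classical_points D"
  then obtain y where "(x, y) \<in> over D \<or> (y, x) \<in> over D"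
    by (rule classical_pointsE)
  then have "double_pair D x y"
    using over_double_pair[OF assms] double_pair_sym by blast
  then show "x \<in> double_points D"
    unfolding double_points_def by blast
qed

lemma finite_classical_points:
  assumes "virtual_link_diagram D"
  shows "finite (classical_points D)"
proof (rule finite_subset[OF classical_points_subset_double_points[OF assms]])
  show "finite (double_points D)"
    using assms unfolding virtual_link_diagram_def by (elim conjE)
qed

lemma classical_points_bounds:
  assumes "virtual_link_diagram D" "(a, s) \<in> classical_points D"
  shows "a \<in> arcs D" "0 < s" "s < 1"
proof -
  have "(a, s) \<in> double_points D"
    using assms classical_points_subset_double_points by blast
  then obtain y where y: "double_pair D (a, s) y"
    unfolding double_points_def by blast
  then show "a \<in> arcs D" "s < 1"
    unfolding double_pair_def points_def by auto
  have "0 < snd (a, s)"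
    using y assms(1) unfolding virtual_link_diagram_def by blast
  then show "0 < s" by simp
qed

lemma over_classical_points:
  "(x, y) \<in> over D \<Longrightarrow> x \<in> classical_points D" "(x, y) \<in> over D \<Longrightarrow> y \<in> classical_points D"
  unfolding classical_points_def by blast+

lemma sgn_crossing:
  assumes "virtual_link_diagram D" "(x, y) \<in> over D"
  shows "sgn (cross_det (vel D x) (vel D y)) = 1 \<or> sgn (cross_det (vel D x) (vel D y)) = -1"
proof -
  have "cross_det (vel D x) (vel D y) \<noteq> 0"
    using over_double_pair[OF assms] assms(1) unfolding virtual_link_diagram_def by blast
  then show ?thesis by (simp add: sgn_if)
qed

lemma band_width_exists_le:
  assumes D: "virtual_link_diagram D" and w0: "0 < w0"
  shows "\<exists>w\<le>w0. band_width D w"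
proof -
  let ?C = "classical_points D"
  define M where "M = snd ` ?C \<union> (\<lambda>x. 1 - snd x) ` ?C \<union>
    (\<lambda>(x, y). \<bar>snd x - snd y\<bar>) ` {(x, y) \<in> ?C \<times> ?C. snd x \<noteq> snd y}"
  have fin: "finite M"
    unfolding M_def using finite_classical_points[OF D]
    by (auto intro!: finite_imageI intro: finite_subset[of _ "?C \<times> ?C"])
  have pos: "0 < m" if "m \<in> M" for m
    using that classical_points_bounds[OF D] unfolding M_def by auto
  define d where "d = Min (insert w0 M)"
  have d0: "0 < d" and dw: "d \<le> w0" and dM: "\<And>m. m \<in> M \<Longrightarrow> d \<le> m"
    using fin pos w0 unfolding d_def by (auto simp: Min_gr_iff)
  have "band_width D (d / 3)"
    unfolding band_width_def
  proof (intro conjI allI impI)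
    show "0 < d / 3" using d0 by simp
  next
    fix a s assume as: "(a, s) \<in> ?C"
    have "s \<in> M" "1 - s \<in> M"
      using as unfolding M_def by force+
    then show "d / 3 < s" "s + d / 3 < 1"
      using dM[of s] dM[of "1 - s"] d0 by linarith+
  next
    fix a s s' assume *: "(a, s) \<in> ?C" "(a, s') \<in> ?C" "s \<noteq> s'"
    have "\<bar>s - s'\<bar> \<in> M"
      unfolding M_def using * by (intro UnI2 image_eqI[of _ _ "((a, s), (a, s'))"]) auto
    then show "2 * (d / 3) < \<bar>s - s'\<bar>"
      using dM[of "\<bar>s - s'\<bar>"] d0 by linarith
  qed
  then show ?thesis using dw d0 by (intro exI[of _ "d / 3"]) auto
qed

section \<open>Edge colorings\<close>

text \<open>
  The value of \<open>g a t\<close> stands for the color on the left of the arc \<open>a\<close> at the time \<open>t\<close>. At a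
  crossing, it suffices to look at distances up to the width of the bands.
\<close>

definition edge_coloring ::
  "'a vdiagram \<Rightarrow> 'a set \<Rightarrow> real \<Rightarrow> ('a \<Rightarrow> real \<Rightarrow> bool) \<Rightarrow> bool" where
  "edge_coloring D P w g \<longleftrightarrow>
     (\<forall>a\<in>arcs D. \<forall>s t. 0 \<le> s \<longrightarrow> s \<le> t \<longrightarrow> t \<le> 1 \<longrightarrow>
        (\<forall>r\<in>{s..t}. (a, r) \<notin> classical_points D) \<longrightarrow> g a s = g a t) \<and>
     (\<forall>a\<in>arcs D. g (nxt D a) 0 = (g a 1 \<noteq> (nxt D a \<in> P))) \<and>
     (\<forall>a s b t. ((a, s), (b, t)) \<in> over D \<longrightarrow> (\<forall>u\<in>{0<..w}. \<forall>v\<in>{0<..w}.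
        g a (s - v) \<noteq> g a (s + v) \<and> g b (t - u) \<noteq> g b (t + u) \<and> g a (s + v) \<noteq> g b (t + u)))"

lemma edge_coloring_const:
  assumes "edge_coloring D P w g" "a \<in> arcs D" "0 \<le> s" "s \<le> t" "t \<le> 1"
    and "\<And>r. s \<le> r \<Longrightarrow> r \<le> t \<Longrightarrow> (a, r) \<notin> classical_points D"
  shows "g a s = g a t"
proof -
  have "0 \<le> s \<longrightarrow> s \<le> t \<longrightarrow> t \<le> 1 \<longrightarrow>
      (\<forall>r\<in>{s..t}. (a, r) \<notin> classical_points D) \<longrightarrow> g a s = g a t"
    using assms(1)[unfolded edge_coloring_def, THEN conjunct1] assms(2) by blast
  then show ?thesis using assms(3-6) by simp
qed

lemma edge_coloring_joint:
  assumes "edge_coloring D P w g" "a \<in> arcs D"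
  shows "g (nxt D a) 0 = (g a 1 \<noteq> (nxt D a \<in> P))"
  using assms unfolding edge_coloring_def by blast

lemma edge_coloring_crossing:
  assumes "edge_coloring D P w g" "((a, s), (b, t)) \<in> over D" "0 < u" "u \<le> w" "0 < v" "v \<le> w"
  shows "g a (s - v) \<noteq> g a (s + v)" "g b (t - u) \<noteq> g b (t + u)" "g a (s + v) \<noteq> g b (t + u)"
proof -
  have "\<forall>u\<in>{0<..w}. \<forall>v\<in>{0<..w}.
      g a (s - v) \<noteq> g a (s + v) \<and> g b (t - u) \<noteq> g b (t + u) \<and> g a (s + v) \<noteq> g b (t + u)"
    using assms(1)[unfolded edge_coloring_def, THEN conjunct2, THEN conjunct2] assms(2) by blast
  then show "g a (s - v) \<noteq> g a (s + v)" "g b (t - u) \<noteq> g b (t + u)" "g a (s + v) \<noteq> g b (t + u)"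
    using assms(3-6) by (metis greaterThanAtMost_iff)+
qed

definition side_color :: "('a \<Rightarrow> real \<Rightarrow> bool) \<Rightarrow> 'a \<times> real \<times> real \<Rightarrow> bool" where
  "side_color g = (\<lambda>(a, t, u). g a t = (0 < u))"

lemma side_color_uminus: "u \<noteq> 0 \<Longrightarrow> side_color g (a, t, - u) = (\<not> side_color g (a, t, u))"
  by (auto simp: side_color_def)

section \<open>The complement of the core\<close>

text \<open>
  The core in the band of \<open>a\<close> consists of the central line and, at each classical crossing, the
  central line of the other band.
\<close>

definition off_core :: "'a vdiagram \<Rightarrow> 'a \<times> real \<times> real \<Rightarrow> bool" where
  "off_core D = (\<lambda>(a, t, u). u \<noteq> 0 \<and> (a, t) \<notin> classical_points D)"

lemma topspace_bands: "topspace (bands D w) = arcs D \<times> {0..1} \<times> {-w..w}"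
  unfolding bands_def by simp

lemma ald_proj_eq_iff: "ald_proj D P w x = ald_proj D P w y \<longleftrightarrow> equivclp (glue D P w) x y"
  unfolding ald_proj_def
  by (auto intro: equivclp_sym equivclp_trans)

lemma glue_imp_ald_proj_eq: "glue D P w x y \<Longrightarrow> ald_proj D P w x = ald_proj D P w y"
  by (simp add: ald_proj_eq_iff r_into_equivclp)

context
  fixes D :: "'a vdiagram" and P :: "'a set" and w :: real
  assumes D: "virtual_link_diagram D" and w: "band_width D w"
begin

lemma width_pos: "0 < w"
  using w unfolding band_width_def by blast

lemma near_crossing:
  assumes "(a, s) \<in> classical_points D" "\<bar>v\<bar> \<le> w"
  shows "0 \<le> s + v" "s + v \<le> 1" "(a, s + v) \<in> classical_points D \<longleftrightarrow> v = 0"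
proof -
  have "w < s" "s + w < 1"
    using w assms(1) unfolding band_width_def by blast+
  then show "0 \<le> s + v" "s + v \<le> 1" using assms(2) by linarith+
  show "(a, s + v) \<in> classical_points D \<longleftrightarrow> v = 0"
  proof
    assume v: "(a, s + v) \<in> classical_points D"
    show "v = 0"
    proof (rule ccontr)
      assume "v \<noteq> 0"
      then have "2 * w < \<bar>s - (s + v)\<bar>"
        using w assms(1) v unfolding band_width_def by (metis add_cancel_right_right)
      then show False using assms(2) width_pos by linarith
    qed
  qed (use assms in simp)
qed

lemma joint_not_classical: "(a, 0) \<notin> classical_points D" "(a, 1) \<notin> classical_points D"
  using classical_points_bounds[OF D] by force+

lemma off_core_glue:
  assumes "glue D P w x y"
  shows "off_core D x \<longleftrightarrow> off_core D y"
  using assms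
proof cases
  case (joint a u)
  then show ?thesis by (auto simp: off_core_def joint_not_classical)
next
  case (crossing a s b t v u \<sigma>)
  have \<sigma>: "\<sigma> = 1 \<or> \<sigma> = -1"
    using sgn_crossing[OF D crossing(3)] crossing by simp
  have "(a, s + v) \<in> classical_points D \<longleftrightarrow> v = 0"
    using crossing near_crossing over_classical_points by (metis abs_le_iff atLeastAtMost_iff minus_le_iff)
  moreover have "(b, t + \<sigma> * u) \<in> classical_points D \<longleftrightarrow> \<sigma> * u = 0"
    using crossing \<sigma> by (intro near_crossing) (auto dest: over_classical_points)
  ultimately show ?thesis
    using \<sigma> by (auto simp: off_core_def crossing(1,2))
qed

lemma off_core_ald_proj:
  assumes "ald_proj D P w x = ald_proj D P w y"
  shows "off_core D x \<longleftrightarrow> off_core D y"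
proof -
  have "equivclp (glue D P w) x y" using assms by (simp add: ald_proj_eq_iff)
  then show ?thesis
    by (induction rule: equivclp_induct) (auto dest: off_core_glue)
qed

text \<open>
  At a crossing, a point \<open>(a, s, u)\<close> of the band of \<open>a\<close> is identified with a point on the central
  line of the band of the other strand.
\<close>

lemma ald_proj_in_core_iff:
  assumes x: "x \<in> topspace (bands D w)"
  shows "ald_proj D P w x \<in> ald_core D P w \<longleftrightarrow> \<not> off_core D x"
proof
  assume "ald_proj D P w x \<in> ald_core D P w"
  then obtain a t where "ald_proj D P w x = ald_proj D P w (a, t, 0)"
    unfolding ald_core_def by blast
  moreover have "\<not> off_core D (a, t, 0)" by (simp add: off_core_def)
  ultimately show "\<not> off_core D x"
    using off_core_ald_proj by blast
next
  assume "\<not> off_core D x"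
  obtain a s u where xa: "x = (a, s, u)" by (cases x)
  have a: "a \<in> arcs D" "s \<in> {0..1}" "u \<in> {-w..w}"
    using x by (auto simp: topspace_bands xa)
  consider "u = 0" | "(a, s) \<in> classical_points D"
    using \<open>\<not> off_core D x\<close> by (auto simp: off_core_def xa)
  then show "ald_proj D P w x \<in> ald_core D P w"
  proof cases
    case 1
    then show ?thesis unfolding ald_core_def xa using a by blast
  next
    case 2
    then obtain y where y: "((a, s), y) \<in> over D \<or> (y, (a, s)) \<in> over D"
      by (rule classical_pointsE)
    obtain b t where yb: "y = (b, t)" by (cases y)
    have bcl: "(b, t) \<in> classical_points D"
      using y yb over_classical_points by metis
    have "\<exists>u'. \<bar>u'\<bar> \<le> w \<and> ald_proj D P w x = ald_proj D P w (b, t + u', 0)"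
      using y
    proof
      assume o: "((a, s), y) \<in> over D"
      define \<sigma> where "\<sigma> = sgn (cross_det (vel D (a, s)) (vel D (b, t)))"
      have \<sigma>: "\<sigma> = 1 \<or> \<sigma> = -1" using sgn_crossing[OF D o] by (simp add: \<sigma>_def yb)
      have "glue D P w (a, s + 0, u) (b, t + \<sigma> * u, - \<sigma> * 0)"
        using o a width_pos by (intro glue.crossing) (auto simp: yb \<sigma>_def)
      then have "ald_proj D P w x = ald_proj D P w (b, t + \<sigma> * u, 0)"
        using glue_imp_ald_proj_eq by (fastforce simp: xa)
      moreover have "\<bar>\<sigma> * u\<bar> \<le> w" using \<sigma> a by auto
      ultimately show ?thesis by blast
    next
      assume o: "(y, (a, s)) \<in> over D"
      define \<sigma> where "\<sigma> = sgn (cross_det (vel D (b, t)) (vel D (a, s)))"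
      have \<sigma>: "\<sigma> = 1 \<or> \<sigma> = -1" using sgn_crossing[OF D o] by (simp add: \<sigma>_def yb)
      have "glue D P w (b, t + (- \<sigma> * u), 0) (a, s + \<sigma> * 0, - \<sigma> * (- \<sigma> * u))"
        using o a width_pos \<sigma> by (intro glue.crossing) (auto simp: yb \<sigma>_def)
      moreover have "- \<sigma> * (- \<sigma> * u) = u" using \<sigma> by auto
      ultimately have "glue D P w (b, t + (- \<sigma> * u), 0) (a, s, u)"
        by (simp only: mult_zero_right add_0_right)
      then have "ald_proj D P w x = ald_proj D P w (b, t + (- \<sigma> * u), 0)"
        unfolding xa by (rule glue_imp_ald_proj_eq[symmetric])
      moreover have "\<bar>- \<sigma> * u\<bar> \<le> w" using \<sigma> a by auto
      ultimately show ?thesis by blast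
    qed
    then obtain u' where u': "\<bar>u'\<bar> \<le> w" "ald_proj D P w x = ald_proj D P w (b, t + u', 0)"
      by blast
    moreover have "t + u' \<in> {0..1}" using near_crossing[OF bcl u'(1)] by simp
    moreover have "b \<in> arcs D" using classical_points_bounds[OF D bcl] by simp
    ultimately show ?thesis unfolding ald_core_def by blast
  qed
qed

definition core_complement :: "('a \<times> real \<times> real) set topology" where
  "core_complement =
     subtopology (ald_surface D P w) (topspace (ald_surface D P w) - ald_core D P w)"

lemma topspace_ald_surface: "topspace (ald_surface D P w) = ald_proj D P w ` topspace (bands D w)"
  unfolding ald_surface_def by simp

lemma topspace_core_complement:
  "topspace core_complement = ald_proj D P w ` {x \<in> topspace (bands D w). off_core D x}"
  unfolding core_complement_def topspace_subtopology topspace_ald_surface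
  using ald_proj_in_core_iff by auto

section \<open>From checkerboard colorings to edge colorings\<close>

text \<open>
  A side of an edge is the image of a connected piece of its band, so it lies in a single region.
\<close>

lemma same_region:
  assumes C: "connected C" and sub: "{a} \<times> C \<subseteq> {x \<in> topspace (bands D w). off_core D x}"
    and xy: "x \<in> C" "y \<in> C"
  shows "connected_component_of_set core_complement (ald_proj D P w (a, x)) =
    connected_component_of_set core_complement (ald_proj D P w (a, y))"
proof -
  have a: "a \<in> arcs D" and C': "C \<subseteq> {0..1} \<times> {-w..w}"
    using sub xy by (auto simp: topspace_bands)
  have "connectedin (bands D w) ({a} \<times> C)"
    unfolding bands_def using a C C'
    by (simp add: connectedin_Times connectedin_subtopology)
  moreover have "continuous_map (bands D w) (ald_surface D P w) (ald_proj D P w)"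
    unfolding ald_surface_def
    by (intro quotient_imp_continuous_map quotient_map_quotient_topology)
  ultimately have "connectedin (ald_surface D P w) (ald_proj D P w ` ({a} \<times> C))"
    by (rule connectedin_continuous_map_image[rotated])
  moreover have "ald_proj D P w ` ({a} \<times> C) \<subseteq> topspace (ald_surface D P w) - ald_core D P w"
    using sub ald_proj_in_core_iff unfolding topspace_ald_surface by fastforce
  ultimately have "connectedin core_complement (ald_proj D P w ` ({a} \<times> C))"
    unfolding core_complement_def by (simp add: connectedin_subtopology)
  then have "connected_component_of core_complement (ald_proj D P w (a, x)) (ald_proj D P w (a, y))"
    unfolding connected_component_of_def using xy by blast
  then show ?thesis
    by (metis connected_component_of_equiv)
qed

lemma colorable_imp_edge_coloring:
  assumes "checkerboard_colorable D P w"
  shows "\<exists>g. edge_coloring D P w g"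
proof -
  obtain black :: "('a \<times> real \<times> real) set set \<Rightarrow> bool" where black:
    "\<And>R R'. R \<in> ald_regions D P w \<Longrightarrow> R' \<in> ald_regions D P w \<Longrightarrow> ald_adjacent D P w R R' \<Longrightarrow>
       black R \<noteq> black R'"
    using assms unfolding checkerboard_colorable_def by blast
  define reg where "reg x = connected_component_of_set core_complement (ald_proj D P w x)" for x
  define g where "g a t = black (reg (a, t, w))" for a t
  let ?off = "{x \<in> topspace (bands D w). off_core D x}"
  have region: "reg x \<in> ald_regions D P w" "ald_proj D P w x \<in> reg x" if "x \<in> ?off" for x
  proof -
    have "ald_proj D P w x \<in> topspace core_complement"
      using that unfolding topspace_core_complement by blast
    then show "reg x \<in> ald_regions D P w" "ald_proj D P w x \<in> reg x"
      unfolding ald_regions_def reg_def core_complement_def[symmetric]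
      by (auto simp: connected_component_in_connected_components_of connected_component_of_refl)
  qed
  \<comment> \<open>the two sides of an edge have different colors, so that the color of each side is known
      once the color of the left side is\<close>
  have side: "black (reg x) = side_color g x" if x: "x \<in> ?off" for x
  proof -
    obtain a t u where xa: "x = (a, t, u)" by (cases x)
    have a: "a \<in> arcs D" "t \<in> {0..1}" "u \<in> {-w..w}" "u \<noteq> 0" "(a, t) \<notin> classical_points D"
      using x by (auto simp: topspace_bands off_core_def xa)
    have left: "reg (a, t, u') = reg (a, t, w)" if "u' \<in> {0<..w}" for u'
      unfolding reg_def
      using a width_pos that
      by (intro same_region[of "{t} \<times> {0<..w}"])
         (auto intro: connected_Times simp: topspace_bands off_core_def)
    show ?thesis
    proof (cases "0 < u")
      case True
      then show ?thesis using left[of u] a by (simp add: xa g_def side_color_def)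
    next
      case False
      then have u: "- u \<in> {0<..w}" using a by auto
      then have off: "(a, t, - u) \<in> ?off"
        using a by (auto simp: topspace_bands off_core_def)
      have "ald_adjacent D P w (reg (a, t, - u)) (reg (a, t, - (- u)))"
        unfolding ald_adjacent_def using a u region(2)[OF off] region(2)[OF x]
        by (intro bexI[of _ a] bexI[of _ t] bexI[of _ "- u"]) (auto simp: xa)
      then have "black (reg (a, t, - u)) \<noteq> black (reg x)"
        using black region(1)[OF off] region(1)[OF x] by (simp add: xa)
      then show ?thesis
        using left[OF u] False by (simp add: xa g_def side_color_def)
    qed
  qed
  have glue_side: "side_color g x = side_color g y"
    if "glue D P w x y" "x \<in> ?off" "y \<in> topspace (bands D w)" for x y
  proof -
    have "y \<in> ?off" using that off_core_glue by blast
    moreover have "reg x = reg y"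
      unfolding reg_def using glue_imp_ald_proj_eq[OF that(1)] by simp
    ultimately show ?thesis using side that(2) by metis
  qed
  have "edge_coloring D P w g"
    unfolding edge_coloring_def
  proof (intro conjI ballI allI impI)
    fix a s t
    assume a: "a \<in> arcs D" "0 \<le> s" "s \<le> t" "t \<le> 1"
      and cl: "\<forall>r\<in>{s..t}. (a, r) \<notin> classical_points D"
    have "reg (a, s, w) = reg (a, t, w)"
      unfolding reg_def using a cl width_pos
      by (intro same_region[of "{s..t} \<times> {w}"])
         (auto intro: connected_Times simp: topspace_bands off_core_def)
    then show "g a s = g a t" unfolding g_def by simp
  next
    fix a assume a: "a \<in> arcs D"
    have n: "nxt D a \<in> arcs D"
      using D a unfolding virtual_link_diagram_def by (metis bij_betwE)
    have "side_color g (a, 1, w) =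
        side_color g (nxt D a, 0, if nxt D a \<in> P then - w else w)"
      using a n width_pos joint_not_classical
      by (intro glue_side glue.joint) (auto simp: topspace_bands off_core_def)
    then show "g (nxt D a) 0 = (g a 1 \<noteq> (nxt D a \<in> P))"
      using width_pos by (auto simp: side_color_def)
  next
    fix a s b t u v
    assume o: "((a, s), (b, t)) \<in> over D" and uv: "u \<in> {0<..w}" "v \<in> {0<..w}"
    define \<sigma> where "\<sigma> = sgn (cross_det (vel D (a, s)) (vel D (b, t)))"
    have \<sigma>: "\<sigma> = 1 \<or> \<sigma> = -1" using sgn_crossing[OF D o] by (simp add: \<sigma>_def)
    have cl: "(a, s) \<in> classical_points D" "(b, t) \<in> classical_points D"
      using over_classical_points[OF o] by auto
    have arc: "a \<in> arcs D" "b \<in> arcs D"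
      using cl classical_points_bounds[OF D] by blast+
    have quadrant: "side_color g (a, s + v', u') = side_color g (b, t + \<sigma> * u', - \<sigma> * v')"
      if "\<bar>v'\<bar> \<le> w" "\<bar>u'\<bar> \<le> w" "v' \<noteq> 0" "u' \<noteq> 0" for u' v'
    proof (rule glue_side)
      show "glue D P w (a, s + v', u') (b, t + \<sigma> * u', - \<sigma> * v')"
        using o that by (intro glue.crossing) (auto simp: \<sigma>_def)
      show "(a, s + v', u') \<in> ?off"
        using near_crossing[OF cl(1) that(1)] that arc
        by (auto simp: topspace_bands off_core_def)
      have "\<bar>\<sigma> * u'\<bar> \<le> w" using \<sigma> that by auto
      then show "(b, t + \<sigma> * u', - \<sigma> * v') \<in> topspace (bands D w)"
        using near_crossing[OF cl(2)] \<sigma> that arc by (auto simp: topspace_bands)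
    qed
    show "g a (s - v) \<noteq> g a (s + v)" "g b (t - u) \<noteq> g b (t + u)" "g a (s + v) \<noteq> g b (t + u)"
      using quadrant[of v u] quadrant[of v "- u"] quadrant[of "- v" u] quadrant[of "- v" "- u"]
        uv \<sigma> by (auto simp: side_color_def)
  qed
  then show ?thesis by blast
qed

section \<open>From edge colorings to checkerboard colorings\<close>

text \<open>
  At a crossing, the core cuts the common square of the two bands into four quadrants, which the
  rules of an edge coloring color alternately. Changing the sign of the crossing rotates the
  identification of the two squares by a half turn, which preserves an alternating coloring;
  so the two signs can be treated alike.
\<close>

lemma side_color_glue:
  assumes g: "edge_coloring D P w g" and xy: "glue D P w x y" and off: "off_core D x"
  shows "side_color g x = side_color g y"
  using xy
proof cases
  case (joint a u)
  then have "u \<noteq> 0" using off by (simp add: off_core_def)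
  then show ?thesis
    using edge_coloring_joint[OF g joint(3)] by (auto simp: joint(1,2) side_color_def)
next
  case (crossing a s b t v u \<sigma>)
  have \<sigma>: "\<sigma> = 1 \<or> \<sigma> = -1"
    using sgn_crossing[OF D crossing(3)] crossing by simp
  have uv: "u \<noteq> 0" "v \<noteq> 0"
    using off over_classical_points[OF crossing(3)] by (auto simp: off_core_def crossing(1))
  have "0 < \<bar>u\<bar>" "\<bar>u\<bar> \<le> w" "0 < \<bar>v\<bar>" "\<bar>v\<bar> \<le> w"
    using crossing uv by auto
  note * = edge_coloring_crossing[OF g crossing(3) this]
  consider "0 < u" "0 < v" | "u < 0" "0 < v" | "0 < u" "v < 0" | "u < 0" "v < 0"
    using uv by linarith
  then show ?thesis
    using * \<sigma> by cases (auto simp: crossing(1,2) side_color_def)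
qed

lemma side_color_ald_proj:
  assumes g: "edge_coloring D P w g" and xy: "ald_proj D P w x = ald_proj D P w y"
    and off: "off_core D x"
  shows "side_color g x = side_color g y"
proof -
  have "equivclp (glue D P w) x y" using xy by (simp add: ald_proj_eq_iff)
  then have "off_core D y \<and> side_color g x = side_color g y"
  proof (induction rule: equivclp_induct)
    case base
    then show ?case using off by simp
  next
    case (step y z)
    then show ?case using off_core_glue side_color_glue[OF g] by metis
  qed
  then show ?thesis ..
qed

lemma openin_bands_side_color:
  assumes g: "edge_coloring D P w g"
  shows "openin (bands D w) {x \<in> topspace (bands D w). off_core D x \<and> side_color g x = c}"
    (is "openin _ ?S")
  unfolding bands_def openin_prod_topology_alt
proof (intro allI impI)
  fix a and z :: "real \<times> real"
  assume "(a, z) \<in> {x \<in> topspace (prod_topology (discrete_topology (arcs D))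
      (top_of_set ({0..1} \<times> {-w..w}))). off_core D x \<and> side_color g x = c}"
  moreover obtain t u where z: "z = (t, u)" by (cases z)
  ultimately have a: "a \<in> arcs D" "t \<in> {0..1}" "u \<in> {-w..w}" "u \<noteq> 0"
    "(a, t) \<notin> classical_points D" and c: "side_color g (a, t, u) = c"
    by (auto simp: off_core_def)
  have "finite {s. (a, s) \<in> classical_points D}"
    using finite_classical_points[OF D] by (rule finite_imageI[of _ snd, THEN finite_subset[rotated]]) force
  then obtain d where d: "0 < d" "\<And>s. (a, s) \<in> classical_points D \<Longrightarrow> d \<le> dist t s"
    using finite_set_avoid[of "{s. (a, s) \<in> classical_points D}" t] a(5) by auto
  have free: "(a, s) \<notin> classical_points D" if "s \<in> ball t d" for s
    using d(2)[of s] that by auto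
  define U where "U = {u'. sgn u' = sgn u}"
  have "U = (if 0 < u then {0<..} else {..<0})"
    using a(4) by (auto simp: U_def sgn_if split: if_splits)
  then have "open U" by simp
  then have "openin (top_of_set ({0..1} \<times> {-w..w})) (({0..1} \<times> {-w..w}) \<inter> (ball t d \<times> U))"
    by (intro openin_open_Int open_Times) auto
  moreover have "(a, t', u') \<in> ?S"
    if "(t', u') \<in> ({0..1} \<times> {-w..w}) \<inter> (ball t d \<times> U)" for t' u'
  proof -
    have t': "t' \<in> ball t d" "t' \<in> {0..1}" and u': "sgn u' = sgn u"
      using that by (auto simp: U_def)
    have between: "r \<in> ball t d" if "min t t' \<le> r" "r \<le> max t t'" for r
      using t'(1) that by (auto simp: dist_real_def)
    have "g a t' = g a t"
    proof (cases "t \<le> t'")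
      case True
      then show ?thesis
        using edge_coloring_const[OF g a(1), of t t'] free between a t' by auto
    next
      case False
      then show ?thesis
        using edge_coloring_const[OF g a(1), of t' t] free between a t' by auto
    qed
    moreover have "u' \<noteq> 0" "0 < u' \<longleftrightarrow> 0 < u"
      using u' a(4) by (auto simp: sgn_if split: if_splits)
    ultimately show ?thesis
      using that a c free[OF t'(1)] by (auto simp: topspace_bands off_core_def side_color_def)
  qed
  moreover have "z \<in> ({0..1} \<times> {-w..w}) \<inter> (ball t d \<times> U)"
    using a d by (auto simp: z U_def)
  ultimately show "\<exists>U V. openin (discrete_topology (arcs D)) U \<and>
      openin (top_of_set ({0..1} \<times> {-w..w})) V \<and> a \<in> U \<and> z \<in> V \<and>
      U \<times> V \<subseteq> {x \<in> topspace (prod_topology (discrete_topology (arcs D))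
        (top_of_set ({0..1} \<times> {-w..w}))). off_core D x \<and> side_color g x = c}"
    using a(1) unfolding bands_def
    by (intro exI[of _ "{a}"] exI[of _ "({0..1} \<times> {-w..w}) \<inter> (ball t d \<times> U)"]) auto
qed

text \<open>
  The points of either color form an open subset of the complement of the core; hence a
  region, being connected, has a single color.
\<close>

lemma edge_coloring_imp_colorable:
  assumes g: "edge_coloring D P w g"
  shows "checkerboard_colorable D P w"
proof -
  define S where "S c = {x \<in> topspace (bands D w). off_core D x \<and> side_color g x = c}" for c
  define T where "T c = ald_proj D P w ` S c" for c
  have saturated: "x \<in> S c" if x: "x \<in> topspace (bands D w)" "ald_proj D P w x \<in> T c" for x c
  proof -
    obtain y where y: "off_core D y" "side_color g y = c" "ald_proj D P w x = ald_proj D P w y"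
      using x(2) unfolding T_def S_def by blast
    then have "off_core D x" using off_core_ald_proj by blast
    moreover have "side_color g x = c"
      using side_color_ald_proj[OF g y(3) \<open>off_core D x\<close>] y(2) by simp
    ultimately show ?thesis using x(1) by (simp add: S_def)
  qed
  have "openin (ald_surface D P w) (T c)" for c
  proof -
    have "{x \<in> topspace (bands D w). ald_proj D P w x \<in> T c} \<subseteq> S c"
      using saturated by blast
    moreover have "S c \<subseteq> {x \<in> topspace (bands D w). ald_proj D P w x \<in> T c}"
      unfolding T_def S_def by blast
    ultimately have "{x \<in> topspace (bands D w). ald_proj D P w x \<in> T c} = S c"
      by (rule subset_antisym)
    moreover have "T c \<subseteq> ald_proj D P w ` topspace (bands D w)"
      by (auto simp: T_def S_def)
    ultimately show ?thesis
      unfolding ald_surface_def openin_quotient_topology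
      using openin_bands_side_color[OF g, of c] by (simp add: S_def)
  qed
  moreover have T_sub: "T c \<subseteq> topspace core_complement" for c
    unfolding topspace_core_complement T_def S_def by blast
  ultimately have T_open: "openin core_complement (T c)" for c
    unfolding core_complement_def
    by (simp add: openin_subtopology_Int2 inf.absorb_iff2 openin_subtopology) blast
  have T_cover: "topspace core_complement \<subseteq> T True \<union> T False"
    unfolding topspace_core_complement T_def S_def by auto
  have T_disjoint: "T True \<inter> T False = {}"
  proof -
    have "S True \<inter> S False = {}" "S True \<subseteq> topspace (bands D w)"
      unfolding S_def by auto
    then show ?thesis using saturated[where c = False] unfolding T_def[of True] by blast
  qed
  have mono: "R \<subseteq> T c" if "R \<in> ald_regions D P w" "R \<inter> T c \<noteq> {}" for R c
  proof -
    have R: "connectedin core_complement R"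
      using that(1) unfolding ald_regions_def core_complement_def[symmetric]
      by (rule connectedin_connected_components_of)
    then have cover: "R \<subseteq> T True \<union> T False"
      using T_cover connectedin_subset_topspace by blast
    then have "R \<inter> T True = {} \<or> R \<inter> T False = {}"
      using connectedinD[OF R T_open[of True] T_open[of False]] T_disjoint by blast
    then show ?thesis
      using that(2) cover by (cases c) (simp_all only:, blast+)
  qed
  have "(R \<subseteq> T True) \<noteq> (R' \<subseteq> T True)"
    if R: "R \<in> ald_regions D P w" "R' \<in> ald_regions D P w" and adj: "ald_adjacent D P w R R'" for R R'
  proof -
    obtain a t u where a: "a \<in> arcs D" "t \<in> {0..1}" "u \<in> {0<..w}"
      and x: "ald_proj D P w (a, t, u) \<in> R" and y: "ald_proj D P w (a, t, - u) \<in> R'"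
      using adj unfolding ald_adjacent_def by blast
    have top: "(a, t, u) \<in> topspace (bands D w)" "(a, t, - u) \<in> topspace (bands D w)"
      using a by (auto simp: topspace_bands)
    have "R \<subseteq> topspace core_complement"
      using R(1) unfolding ald_regions_def core_complement_def[symmetric]
      by (rule connected_components_of_subset)
    then have "ald_proj D P w (a, t, u) \<notin> ald_core D P w"
      using x unfolding core_complement_def by auto
    then have off: "off_core D (a, t, u)"
      using top ald_proj_in_core_iff by blast
    then have off': "off_core D (a, t, - u)" by (simp add: off_core_def)
    define c where "c = side_color g (a, t, u)"
    have "ald_proj D P w (a, t, u) \<in> T c" "ald_proj D P w (a, t, - u) \<in> T (\<not> c)"
      using top off off' a side_color_uminus[of u g a t]
      unfolding T_def S_def c_def by (auto simp del: minus_zero)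
    then have *: "R \<subseteq> T c" "R' \<subseteq> T (\<not> c)"
      using mono R x y by blast+
    moreover have "R \<noteq> {}" "R' \<noteq> {}" using x y by auto
    ultimately show ?thesis
      using T_disjoint by (cases c) (simp_all only: not_True_eq_False not_False_eq_True, blast+)
  qed
  then show ?thesis
    unfolding checkerboard_colorable_def by (intro exI[of _ "\<lambda>R. R \<subseteq> T True"]) blast
qed

end

section \<open>The coloring of the two copies\<close>

lemma move_simps [simp]:
  "arcs (move h D) = arcs D" "nxt (move h D) = nxt D" "over (move h D) = over D"
  by (simp_all add: move_def)

lemma classical_points_move [simp]: "classical_points (move h D) = classical_points D"
  by (simp add: classical_points_def)

lemma edge_coloring_move [simp]: "edge_coloring (move h D) P w g = edge_coloring D P w g"
  by (simp add: edge_coloring_def)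

lemma double_points_move: "double_points D \<subseteq> double_points (move h D)"
proof
  fix x assume "x \<in> double_points D"
  then obtain y where "double_pair D x y"
    unfolding double_points_def by blast
  then have "double_pair (move h D) x y"
    by (simp add: double_pair_def points_def loc_def move_def)
  then show "x \<in> double_points (move h D)"
    unfolding double_points_def by blast
qed

lemma classical_points_phi_diagram:
  assumes "(a, lo a + r * (hi a - lo a)) \<in> classical_points D" and "lo a < hi a"
  shows "(Kept i a, r) \<in> classical_points (phi_diagram D P \<tau> lo hi \<gamma>)"
proof -
  define s where "s = lo a + r * (hi a - lo a)"
  have r: "(s - lo a) / (hi a - lo a) = r"
    using assms(2) by (simp add: s_def)
  obtain y where "((a, s), y) \<in> over D \<or> (y, (a, s)) \<in> over D"
    using assms(1) unfolding s_def by (rule classical_pointsE)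
  moreover obtain b t where "y = (b, t)" by (cases y)
  ultimately have
    "((Kept i a, r), (Kept i b, (t - lo b) / (hi b - lo b))) \<in> over (phi_diagram D P \<tau> lo hi \<gamma>) \<or>
     ((Kept i b, (t - lo b) / (hi b - lo b)), (Kept i a, r)) \<in> over (phi_diagram D P \<tau> lo hi \<gamma>)"
    unfolding phi_diagram_def using r by fastforce
  then show ?thesis using over_classical_points by metis
qed

text \<open>
  The pieces that are cut off at \<open>p\<close> lie in the strip around \<open>p\<close>, which contains no crossing; so
  the color at a cut end is the one at \<open>p\<close>.
\<close>

lemma thin_cuts_not_classical:
  assumes cuts: "thin_cuts D P \<epsilon> lo hi" and cl: "classical_points D \<subseteq> double_points D"
    and pos: "\<And>b s. (b, s) \<in> classical_points D \<Longrightarrow> 0 < s"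
    and a: "a \<in> arcs D" "nxt D a = p" "p \<in> P" "p \<in> arcs D"
  shows "s \<in> {hi a..1} \<Longrightarrow> (a, s) \<notin> classical_points D"
    and "t \<in> {0..lo p} \<Longrightarrow> (p, t) \<notin> classical_points D"
proof -
  have lohi: "lo a < hi a" "0 \<le> lo a" "hi a \<le> 1" "0 \<le> lo p"
    using cuts a unfolding thin_cuts_def by blast+
  have strip: "crv D a s \<in> strip D \<epsilon> p \<and> crv D p t \<in> strip D \<epsilon> p"
    if "s \<in> {hi a..1}" "t \<in> {0..lo p}" for s t
    using cuts a that unfolding thin_cuts_def by metis
  have no: "(b, s) \<notin> classical_points D" if "crv D b s \<in> strip D \<epsilon> p" for b s
  proof
    assume c: "(b, s) \<in> classical_points D"
    then have "(b, s) \<in> special_points D P" "(b, s) \<noteq> (p, 0)"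
      using cl pos[OF c] unfolding special_points_def by auto
    then have "loc D (b, s) \<notin> strip D \<epsilon> p"
      using cuts a(3) unfolding thin_cuts_def by blast
    then show False using that by (simp add: loc_def)
  qed
  show "(a, s) \<notin> classical_points D" if "s \<in> {hi a..1}"
    using no strip[of s 0] that lohi by simp
  show "(p, t) \<notin> classical_points D" if "t \<in> {0..lo p}"
    using no strip[of 1 t] that lohi by simp
qed

text \<open>
  The color at the cut end of an arc \<open>a\<close> before \<open>p\<close> is the negation of \<open>g p 0\<close>; this explains the
  color of the joining arcs, which start there. Since \<open>hi a - lo a \<le> 1\<close>, the parametrisation of
  what is left of \<open>a\<close> does not stretch the neighborhoods of the crossings beyond \<open>w\<close>.
\<close>

lemma edge_coloring_phi_diagram:
  assumes g: "edge_coloring D P w g" and cuts: "thin_cuts D P \<epsilon> lo hi"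
    and cl: "classical_points D \<subseteq> double_points D"
    and pos: "\<And>b s. (b, s) \<in> classical_points D \<Longrightarrow> 0 < s"
    and over: "\<And>a s b t. ((a, s), (b, t)) \<in> over D \<Longrightarrow> a \<in> arcs D \<and> b \<in> arcs D"
    and nxt: "bij_betw (nxt D) (arcs D) (arcs D)" and P: "P \<subseteq> arcs D" and w': "w' \<le> w"
  shows "\<exists>f. edge_coloring (phi_diagram D P \<tau> lo hi \<gamma>) {} w' f"
proof -
  let ?E = "phi_diagram D P \<tau> lo hi \<gamma>"
  define f where "f = (\<lambda>e t. case e of
      Kept i a \<Rightarrow> g a (lo a + t * (hi a - lo a)) \<noteq> i
    | Joining i p \<Rightarrow> g p 0 = i)"
  have lohi: "0 \<le> lo a" "lo a < hi a" "hi a \<le> 1" "a \<in> P \<longleftrightarrow> 0 < lo a" "nxt D a \<in> P \<longleftrightarrow> hi a < 1"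
    if "a \<in> arcs D" for a
    using cuts that unfolding thin_cuts_def by blast+
  have nxt_arc: "nxt D a \<in> arcs D" if "a \<in> arcs D" for a
    using nxt that by (rule bij_betwE[rule_format])
  have start: "g a (lo a) = g a 0" if a: "a \<in> arcs D" for a
  proof (cases "a \<in> P")
    case True
    have "a \<in> nxt D ` arcs D"
      using bij_betw_imp_surj_on[OF nxt] a by simp
    then obtain b where "b \<in> arcs D" "nxt D b = a" by blast
    then have "g a 0 = g a (lo a)"
      using thin_cuts_not_classical(2)[OF cuts cl pos _ _ True a] lohi[OF a] a
      by (intro edge_coloring_const[OF g]) auto
    then show ?thesis ..
  next
    case False
    then show ?thesis using lohi[OF a] by simp
  qed
  have finish: "g a (hi a) = g a 1" if a: "a \<in> arcs D" for a
  proof (cases "nxt D a \<in> P")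
    case True
    show ?thesis
      using thin_cuts_not_classical(1)[OF cuts cl pos a refl True] nxt_arc[OF a] lohi[OF a] a
      by (intro edge_coloring_const[OF g]) auto
  next
    case False
    then show ?thesis using lohi[OF a] by simp
  qed
  have "edge_coloring ?E {} w' f"
    unfolding edge_coloring_def
  proof (intro conjI ballI allI impI)
    fix e s t
    assume e: "e \<in> arcs ?E" and st: "0 \<le> s" "s \<le> t" "t \<le> 1"
      and free: "\<forall>r\<in>{s..t}. (e, r) \<notin> classical_points ?E"
    show "f e s = f e t"
    proof (cases e)
      case (Kept i a)
      then have a: "a \<in> arcs D" using e by (auto simp: phi_diagram_def)
      define d where "d = hi a - lo a"
      have d: "0 < d" using lohi[OF a] by (simp add: d_def)
      have "g a (lo a + s * d) = g a (lo a + t * d)"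
      proof (rule edge_coloring_const[OF g a])
        show "0 \<le> lo a + s * d" "lo a + s * d \<le> lo a + t * d"
          using st d lohi[OF a] by (auto intro: mult_right_mono)
        have "t * d \<le> d" using st d by (simp add: mult_left_le_one_le)
        then show "lo a + t * d \<le> 1" using lohi(3)[OF a] d_def by linarith
        fix r assume r: "lo a + s * d \<le> r" "r \<le> lo a + t * d"
        then have "(r - lo a) / d \<in> {s..t}"
          using d by (auto simp: field_simps)
        then have "(e, (r - lo a) / d) \<notin> classical_points ?E" using free by blast
        moreover have "lo a + (r - lo a) / d * d = r" using d by simp
        ultimately show "(a, r) \<notin> classical_points D"
          using classical_points_phi_diagram[of a lo "(r - lo a) / d" hi D i P \<tau> \<gamma>] lohi[OF a]
          unfolding Kept d_def by auto
      qed
      then show ?thesis by (simp add: f_def Kept d_def)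
    next
      case (Joining i p)
      then show ?thesis by (simp add: f_def)
    qed
  next
    fix e assume e: "e \<in> arcs ?E"
    show "f (nxt ?E e) 0 = (f e 1 \<noteq> (nxt ?E e \<in> {}))"
    proof (cases e)
      case (Kept i a)
      then have a: "a \<in> arcs D" using e by (auto simp: phi_diagram_def)
      show ?thesis
        using edge_coloring_joint[OF g a] finish[OF a] start[OF nxt_arc[OF a]]
        by (auto simp: f_def Kept phi_diagram_def)
    next
      case (Joining i p)
      then have p: "p \<in> arcs D" using e P by (auto simp: phi_diagram_def)
      show ?thesis using start[OF p] by (auto simp: f_def Joining phi_diagram_def)
    qed
  next
    fix e s' e' t' u v
    assume o: "((e, s'), (e', t')) \<in> vdiagram.over ?E" and uv: "u \<in> {0<..w'}" "v \<in> {0<..w'}"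
    then obtain i a s b t where e: "e = Kept i a" "e' = Kept i b"
      "s' = (s - lo a) / (hi a - lo a)" "t' = (t - lo b) / (hi b - lo b)"
      and ab: "((a, s), (b, t)) \<in> vdiagram.over D"
      unfolding phi_diagram_def vdiagram.simps by blast
    have arc: "a \<in> arcs D" "b \<in> arcs D" using over[OF ab] by auto
    have scale: "0 < x * (hi c - lo c)" "x * (hi c - lo c) \<le> w"
      if "c \<in> arcs D" "x \<in> {0<..w'}" for c x
    proof -
      show "0 < x * (hi c - lo c)" using lohi[OF that(1)] that(2) by simp
      have "x * (hi c - lo c) \<le> x"
        using lohi[OF that(1)] that(2) by (intro mult_left_le) auto
      moreover have "x \<le> w" using that(2) w' by simp
      ultimately show "x * (hi c - lo c) \<le> w" by (rule order_trans)
    qed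
    have shift: "lo a + (s' + x) * (hi a - lo a) = s + x * (hi a - lo a)"
      "lo b + (t' + x) * (hi b - lo b) = t + x * (hi b - lo b)" for x
      using lohi[OF arc(1)] lohi[OF arc(2)] by (auto simp: e distrib_right)
    note edge_coloring_crossing[OF g ab scale[OF arc(2) uv(1)] scale[OF arc(1) uv(2)]]
    then show "f e (s' - v) \<noteq> f e (s' + v)" "f e' (t' - u) \<noteq> f e' (t' + u)"
      "f e (s' + v) \<noteq> f e' (t' + u)"
      using shift(1)[of v] shift(1)[of "- v"] shift(2)[of u] shift(2)[of "- u"]
      unfolding f_def e(1,2) by auto
  qed
  then show ?thesis by blast
qed

theorem proposition4:
  fixes D :: "'a vdiagram" and P :: "'a set" and E :: "'a phi_arc vdiagram"
  assumes "virtual_link_diagram D"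
    and "cut_system D P"
    and "is_phi D P E"
  shows "normal_diagram E"
proof -
  note D = assms(1)
  obtain w where w: "band_width D w" "checkerboard_colorable D P w" and P: "P \<subseteq> arcs D"
    using assms(2) unfolding cut_system_def ald_normal_def by blast
  obtain g where g: "edge_coloring D P w g"
    using colorable_imp_edge_coloring[OF D w] by blast
  obtain h \<tau> \<epsilon> lo hi \<gamma> where cuts: "thin_cuts (move h D) P \<epsilon> lo hi"
    and E: "E = phi_diagram (move h D) P \<tau> lo hi \<gamma>" "virtual_link_diagram E"
    using assms(3) unfolding is_phi_def by blast
  have "0 < w" using w(1) unfolding band_width_def by blast
  then obtain w' where w': "w' \<le> w" "band_width E w'"
    using band_width_exists_le[OF E(2)] by blast
  have "\<exists>f. edge_coloring E {} w' f"
    unfolding E(1)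
  proof (rule edge_coloring_phi_diagram[where w = w and g = g])
    show "classical_points (move h D) \<subseteq> double_points (move h D)"
      using classical_points_subset_double_points[OF D] double_points_move by fastforce
    show "0 < s" if "(b, s) \<in> classical_points (move h D)" for b s
      using that classical_points_bounds[OF D] by simp
    show "a \<in> arcs (move h D) \<and> b \<in> arcs (move h D)"
      if "((a, s), (b, t)) \<in> over (move h D)" for a s b t
      using that over_classical_points[of "(a, s)" "(b, t)" D] classical_points_bounds[OF D]
      by auto
    show "bij_betw (nxt (move h D)) (arcs (move h D)) (arcs (move h D))"
      using D unfolding virtual_link_diagram_def by simp
  qed (use g cuts P w' in auto)
  then have "checkerboard_colorable E {} w'"
    using edge_coloring_imp_colorable[OF E(2) w'(2)] by blast
  then show ?thesis
    unfolding normal_diagram_def ald_normal_def using w'(2) by blast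
qed

end
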